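(* $\mathsf{OTAB}$ does not simulate $\mathsf{MLK}$: there is no polynomial $p$ such that every sequent $\Gamma\vdash_M\Delta$ having an $\mathsf{MLK}$-derivation of size $s$ also has an $\mathsf{OTAB}$-proof of size at most $p(s)$. (Indeed, there are sequents with polynomial-size $\mathsf{MLK}$-derivations for which every $\mathsf{OTAB}$-proof has exponential size.)
   Context: Propositional formulas are built from atoms with $\bot,\top,\neg,\vee,\wedge,\rightarrow$. Models are identified with sets of true atoms, ordered by inclusion. A minimal-entailment sequent $\Gamma\vdash_M\Delta$ is true iff every inclusion-minimal model of $\bigwedge\Gamma$ satisfies $\bigvee\Delta$. A proof system $f$ simulates $g$ if there is a polynomial $p$ such that every $g$-proof $\pi$ has an $f$-proof of the same string of size at most $p(|\pi|)$. $\mathsf{LK}$ is Gentzen's propositional sequent calculus on sequents of finite sets (axioms $A\vdash A$, $\bot\vdash$, $\vdash\top$; weakening; standard left/right rules for $\neg,\wedge,\vee,\rightarrow$; cut). $\mathsf{MLK}$ (Olivetti) consists of all $\mathsf{LK}$ axioms and rules together with: axiom $\Gamma\vdash_M\neg p$ for every atom $p$ not occurring positively in any formula of $\Gamma$ (positive = in scope of an even number of negations and implication antecedents); from $\Gamma\vdash\Delta$ infer $\Gamma\vdash_M\Delta$; M-cut: from $\Gamma\vdash_M\Sigma,A$ and $A,\Gamma\vdash_M\Lambda$ infer $\Gamma\vdash_M\Sigma,\Lambda$; from $\Gamma\vdash_M\Sigma$ and $\Gamma\vdash_M\Delta$ infer $\Gamma,\Sigma\vdash_M\Delta$; from $\Gamma\vdash_M\Sigma,A$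 and $\Gamma\vdash_M\Sigma,B$ infer $\Gamma\vdash_M\Sigma,A\wedge B$; from $A,\Gamma\vdash_M\Sigma$ and $B,\Gamma\vdash_M\Sigma$ infer $A\vee B,\Gamma\vdash_M\Sigma$; from $\Gamma\vdash_M\Sigma,A$ infer $\Gamma\vdash_M\Sigma,B\vee A$ and $\Gamma\vdash_M\Sigma,A\vee B$; from $A,\Gamma\vdash_M\Sigma$ infer $\Gamma\vdash_M\Sigma,\neg A$; from $A,\Gamma\vdash_M\Sigma,B$ infer $\Gamma\vdash_M\Sigma,A\rightarrow B$. $\mathsf{OTAB}$ (Olivetti's tableau): nodes carry signed formulas $T\phi$/$F\phi$, marked or unmarked. $\alpha$-type (components): $T(A\wedge B)$: $TA,TB$; $F\neg(A\wedge B)$: $F\neg A,F\neg B$; $T\neg(A\vee B)$: $T\neg A,T\neg B$; $F(A\vee B)$: $FA,FB$; $T\neg(A\rightarrow B)$: $TA,T\neg B$; $F(A\rightarrow B)$: $F\neg A,FB$; $T\neg\neg A$: $TA,TA$; $F\neg\neg A$: $FA,FA$. $\beta$-type: $T(A\vee B)$: $TA,TB$; $F\neg(A\vee B)$: $F\neg A,F\neg B$; $T\neg(A\wedge B)$: $T\neg A,T\neg B$; $F(A\wedge B)$: $FA,FB$; $T(A\rightarrow B)$: $T\neg A,TB$; $F\neg(A\rightarrow B)$: $FA,F\neg B$. A tableau for $\Gamma\vdash_M\Delta$ starts with one branch of unmarked $T\gamma$ ($\gamma\in\Gamma$), $F\delta$ ($\delta\in\Delta$) and is extended by: (A) mark an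 unmarked $\alpha$-type node of branch $\mathcal B$ and append unmarked $\alpha_1,\alpha_2$; (B) mark an unmarked $\beta$-type node of $\mathcal B$ and split $\mathcal B$ into a branch extended by unmarked $\beta_1$ and one extended by unmarked $\beta_2$. A branch is completed if all its unmarked formulas are literals; closed if it contains $TA,T\neg A$ ($T$-closed) or $FA,F\neg A$ or $TA,FA$. $\mathrm{At}(\mathcal B)$ is the set of atoms $p$ with $Tp$ on $\mathcal B$. $\mathcal B$ is ignorable type-1 if completed and some atom $a$ has $F\neg a$ but not $Ta$ on $\mathcal B$; ignorable type-2 if another branch $\mathcal B'$ is completed, not $T$-closed, with $\mathrm{At}(\mathcal B')\subsetneq\mathrm{At}(\mathcal B)$. An $\mathsf{OTAB}$-proof of $\Gamma\vdash_M\Delta$ is a tableau in which every branch is closed or ignorable. *)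

theory Defs
  imports "HOL-Library.FSet" "HOL-Library.Multiset" "HOL-Computational_Algebra.Polynomial"
begin

datatype fm =
    Atom nat
  | Bot
  | Top
  | Neg fm
  | Or fm fm
  | And fm fm
  | Imp fm fm

text \<open>Sizes count symbol occurrences; in particular every atom counts as one symbol.\<close>

primrec fm_size :: "fm \<Rightarrow> nat" where
  "fm_size (Atom p) = 1"
| "fm_size Bot = 1"
| "fm_size Top = 1"
| "fm_size (Neg A) = fm_size A + 1"
| "fm_size (Or A B) = fm_size A + fm_size B + 1"
| "fm_size (And A B) = fm_size A + fm_size B + 1"
| "fm_size (Imp A B) = fm_size A + fm_size B + 1"

text \<open>\<open>occ True A\<close> and \<open>occ False A\<close> are the sets of atoms with a positive, respectively
  negative, occurrence in \<open>A\<close>; an atom may be in both.\<close>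

primrec occ :: "bool \<Rightarrow> fm \<Rightarrow> nat set" where
  "occ b (Atom p) = (if b then {p} else {})"
| "occ b Bot = {}"
| "occ b Top = {}"
| "occ b (Neg A) = occ (\<not> b) A"
| "occ b (Or A B) = occ b A \<union> occ b B"
| "occ b (And A B) = occ b A \<union> occ b B"
| "occ b (Imp A B) = occ (\<not> b) A \<union> occ b B"


section \<open>The sequent calculi LK and MLK\<close>

text \<open>\<open>Seq \<Gamma> \<Delta>\<close> is the classical sequent, \<open>MSeq \<Gamma> \<Delta>\<close> the minimal-entailment sequent.\<close>

datatype sequent = Seq "fm fset" "fm fset" | MSeq "fm fset" "fm fset"

definition fms_size :: "fm fset \<Rightarrow> nat" where
  "fms_size \<Gamma> = (\<Sum>A \<in> fset \<Gamma>. fm_size A)"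

primrec seq_size :: "sequent \<Rightarrow> nat" where
  "seq_size (Seq \<Gamma> \<Delta>) = fms_size \<Gamma> + fms_size \<Delta> + 1"
| "seq_size (MSeq \<Gamma> \<Delta>) = fms_size \<Gamma> + fms_size \<Delta> + 1"

text \<open>\<open>lk_step Ps S\<close>: the list of premises \<open>Ps\<close> yields \<open>S\<close> by one inference; axioms have no
  premises. As in Gentzen's calculus, cut and left implication combine two contexts.\<close>

inductive lk_step :: "sequent list \<Rightarrow> sequent \<Rightarrow> bool" where
  ax: "lk_step [] (Seq {|A|} {|A|})"
| bot: "lk_step [] (Seq {|Bot|} {||})"
| top: "lk_step [] (Seq {||} {|Top|})"
| weakL: "lk_step [Seq \<Gamma> \<Delta>] (Seq (finsert A \<Gamma>) \<Delta>)"
| weakR: "lk_step [Seq \<Gamma> \<Delta>] (Seq \<Gamma> (finsert A \<Delta>))"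
| negL: "lk_step [Seq \<Gamma> (finsert A \<Delta>)] (Seq (finsert (Neg A) \<Gamma>) \<Delta>)"
| negR: "lk_step [Seq (finsert A \<Gamma>) \<Delta>] (Seq \<Gamma> (finsert (Neg A) \<Delta>))"
| andL1: "lk_step [Seq (finsert A \<Gamma>) \<Delta>] (Seq (finsert (And A B) \<Gamma>) \<Delta>)"
| andL2: "lk_step [Seq (finsert A \<Gamma>) \<Delta>] (Seq (finsert (And B A) \<Gamma>) \<Delta>)"
| andR: "lk_step [Seq \<Gamma> (finsert A \<Delta>), Seq \<Gamma> (finsert B \<Delta>)] (Seq \<Gamma> (finsert (And A B) \<Delta>))"
| orL: "lk_step [Seq (finsert A \<Gamma>) \<Delta>, Seq (finsert B \<Gamma>) \<Delta>] (Seq (finsert (Or A B) \<Gamma>) \<Delta>)"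
| orR1: "lk_step [Seq \<Gamma> (finsert A \<Delta>)] (Seq \<Gamma> (finsert (Or A B) \<Delta>))"
| orR2: "lk_step [Seq \<Gamma> (finsert A \<Delta>)] (Seq \<Gamma> (finsert (Or B A) \<Delta>))"
| impL: "lk_step [Seq \<Gamma> (finsert A \<Sigma>), Seq (finsert B \<Delta>) \<Lambda>]
           (Seq (finsert (Imp A B) (\<Gamma> |\<union>| \<Delta>)) (\<Sigma> |\<union>| \<Lambda>))"
| impR: "lk_step [Seq (finsert A \<Gamma>) (finsert B \<Delta>)] (Seq \<Gamma> (finsert (Imp A B) \<Delta>))"
| cut: "lk_step [Seq \<Gamma> (finsert A \<Sigma>), Seq (finsert A \<Delta>) \<Lambda>] (Seq (\<Gamma> |\<union>| \<Delta>) (\<Sigma> |\<union>| \<Lambda>))"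

text \<open>The parameter \<open>adm\<close> says which sets \<open>\<Sigma>\<close> may be moved to the left by rule \<open>mL\<close>. With no
  restriction this rule is not sound for sets of two or more formulas, as \<open>\<Sigma>\<close> is read
  disjunctively on the right and conjunctively on the left: \<open>{p \<or> q}\<close> minimally entails both
  \<open>{p, q}\<close> and \<open>{\<not> p \<or> \<not> q}\<close>, but \<open>{p \<or> q, p, q}\<close> does not minimally entail \<open>{\<not> p \<or> \<not> q}\<close>.
  For singletons it is sound (cautious monotonicity).\<close>

inductive mlk_step :: "(fm fset \<Rightarrow> bool) \<Rightarrow> sequent list \<Rightarrow> sequent \<Rightarrow> bool"
  for adm :: "fm fset \<Rightarrow> bool" where
  lk: "lk_step Ps S \<Longrightarrow> mlk_step adm Ps S"
| mAx: "(\<And>A. A |\<in>| \<Gamma> \<Longrightarrow> p \<notin> occ True A) \<Longrightarrow> mlk_step adm [] (MSeq \<Gamma> {|Neg (Atom p)|})"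
| embed: "mlk_step adm [Seq \<Gamma> \<Delta>] (MSeq \<Gamma> \<Delta>)"
| mCut: "mlk_step adm [MSeq \<Gamma> (finsert A \<Sigma>), MSeq (finsert A \<Gamma>) \<Lambda>] (MSeq \<Gamma> (\<Sigma> |\<union>| \<Lambda>))"
| mL: "adm \<Sigma> \<Longrightarrow> mlk_step adm [MSeq \<Gamma> \<Sigma>, MSeq \<Gamma> \<Delta>] (MSeq (\<Gamma> |\<union>| \<Sigma>) \<Delta>)"
| mAndR: "mlk_step adm [MSeq \<Gamma> (finsert A \<Sigma>), MSeq \<Gamma> (finsert B \<Sigma>)]
            (MSeq \<Gamma> (finsert (And A B) \<Sigma>))"
| mOrL: "mlk_step adm [MSeq (finsert A \<Gamma>) \<Sigma>, MSeq (finsert B \<Gamma>) \<Sigma>]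
           (MSeq (finsert (Or A B) \<Gamma>) \<Sigma>)"
| mOrR1: "mlk_step adm [MSeq \<Gamma> (finsert A \<Sigma>)] (MSeq \<Gamma> (finsert (Or B A) \<Sigma>))"
| mOrR2: "mlk_step adm [MSeq \<Gamma> (finsert A \<Sigma>)] (MSeq \<Gamma> (finsert (Or A B) \<Sigma>))"
| mNegR: "mlk_step adm [MSeq (finsert A \<Gamma>) \<Sigma>] (MSeq \<Gamma> (finsert (Neg A) \<Sigma>))"
| mImpR: "mlk_step adm [MSeq (finsert A \<Gamma>) (finsert B \<Sigma>)] (MSeq \<Gamma> (finsert (Imp A B) \<Sigma>))"

text \<open>Derivations are sequences of sequents, so a line may be used as a premise several times.\<close>

definition derivation :: "(sequent list \<Rightarrow> sequent \<Rightarrow> bool) \<Rightarrow> sequent list \<Rightarrow> bool" where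
  "derivation R \<pi> \<longleftrightarrow> (\<forall>i < length \<pi>. \<exists>Ps. set Ps \<subseteq> set (take i \<pi>) \<and> R Ps (\<pi> ! i))"

text \<open>A proof system for minimal entailment is given by the relation
  ``\<open>\<Gamma> \<turnstile>\<^sub>M \<Delta>\<close> has a proof of size \<open>s\<close>''.\<close>

type_synonym proof_system = "fm fset \<Rightarrow> fm fset \<Rightarrow> nat \<Rightarrow> bool"

definition mlk_system :: "(fm fset \<Rightarrow> bool) \<Rightarrow> proof_system" where
  "mlk_system adm \<Gamma> \<Delta> s \<longleftrightarrow>
     (\<exists>\<pi>. derivation (mlk_step adm) \<pi> \<and> \<pi> \<noteq> [] \<and> last \<pi> = MSeq \<Gamma> \<Delta> \<and>
          s = (\<Sum>S\<leftarrow>\<pi>. seq_size S))"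

definition MLK :: proof_system where
  "MLK = mlk_system (\<lambda>\<Sigma>. True)"

definition MLK_single :: proof_system where
  "MLK_single = mlk_system (\<lambda>\<Sigma>. \<exists>A. \<Sigma> = {|A|})"


section \<open>The tableau system OTAB\<close>

datatype sfm = Tr fm | Fl fm

primrec sfm_size :: "sfm \<Rightarrow> nat" where
  "sfm_size (Tr A) = fm_size A + 1"
| "sfm_size (Fl A) = fm_size A + 1"

inductive alpha :: "sfm \<Rightarrow> sfm \<Rightarrow> sfm \<Rightarrow> bool" where
  "alpha (Tr (And A B)) (Tr A) (Tr B)"
| "alpha (Fl (Neg (And A B))) (Fl (Neg A)) (Fl (Neg B))"
| "alpha (Tr (Neg (Or A B))) (Tr (Neg A)) (Tr (Neg B))"
| "alpha (Fl (Or A B)) (Fl A) (Fl B)"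
| "alpha (Tr (Neg (Imp A B))) (Tr A) (Tr (Neg B))"
| "alpha (Fl (Imp A B)) (Fl (Neg A)) (Fl B)"
| "alpha (Tr (Neg (Neg A))) (Tr A) (Tr A)"
| "alpha (Fl (Neg (Neg A))) (Fl A) (Fl A)"

inductive beta :: "sfm \<Rightarrow> sfm \<Rightarrow> sfm \<Rightarrow> bool" where
  "beta (Tr (Or A B)) (Tr A) (Tr B)"
| "beta (Fl (Neg (Or A B))) (Fl (Neg A)) (Fl (Neg B))"
| "beta (Tr (Neg (And A B))) (Tr (Neg A)) (Tr (Neg B))"
| "beta (Fl (And A B)) (Fl A) (Fl B)"
| "beta (Tr (Imp A B)) (Tr (Neg A)) (Tr B)"
| "beta (Fl (Neg (Imp A B))) (Fl A) (Fl (Neg B))"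

text \<open>A branch is represented by the multisets of its marked and of its unmarked nodes; the
  order of the nodes on a branch plays no role. Marks belong to a branch: a node shared by two
  branches may be marked on one and unmarked on the other.\<close>

datatype branch = Branch (marked: "sfm multiset") (unmarked: "sfm multiset")

definition on :: "sfm \<Rightarrow> branch \<Rightarrow> bool" where
  "on X B \<longleftrightarrow> X \<in># marked B + unmarked B"

definition init_branch :: "fm fset \<Rightarrow> fm fset \<Rightarrow> branch" where
  "init_branch \<Gamma> \<Delta> = Branch {#} (mset_set (Tr ` fset \<Gamma>) + mset_set (Fl ` fset \<Delta>))"

text \<open>\<open>tableau \<Gamma> \<Delta> \<T> k\<close>: there is a tableau for \<open>\<Gamma> \<turnstile>\<^sub>M \<Delta>\<close> with branches \<open>\<T>\<close> and total size
  \<open>k\<close> of all nodes of the tree. Nodes shared by several branches are counted once in \<open>k\<close>.\<close>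

inductive tableau :: "fm fset \<Rightarrow> fm fset \<Rightarrow> branch multiset \<Rightarrow> nat \<Rightarrow> bool"
  for \<Gamma> \<Delta> :: "fm fset" where
  start: "tableau \<Gamma> \<Delta> {#init_branch \<Gamma> \<Delta>#} (\<Sum>X\<in>#unmarked (init_branch \<Gamma> \<Delta>). sfm_size X)"
| ruleA: "tableau \<Gamma> \<Delta> (add_mset (Branch M (add_mset X U)) \<T>) k \<Longrightarrow> alpha X X1 X2 \<Longrightarrow>
    tableau \<Gamma> \<Delta> (add_mset (Branch (add_mset X M) (add_mset X1 (add_mset X2 U))) \<T>)
      (k + sfm_size X1 + sfm_size X2)"
| ruleB: "tableau \<Gamma> \<Delta> (add_mset (Branch M (add_mset X U)) \<T>) k \<Longrightarrow> beta X X1 X2 \<Longrightarrow>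
    tableau \<Gamma> \<Delta> (add_mset (Branch (add_mset X M) (add_mset X1 U))
                  (add_mset (Branch (add_mset X M) (add_mset X2 U)) \<T>))
      (k + sfm_size X1 + sfm_size X2)"

text \<open>Literals are atoms and negated atoms; the constants are not literals. (Counting \<open>Bot\<close> as
  a literal would make the system unsound, since \<open>Tr Bot\<close> does not close a branch.)\<close>

definition literal :: "fm \<Rightarrow> bool" where
  "literal A \<longleftrightarrow> (\<exists>p. A = Atom p \<or> A = Neg (Atom p))"

definition completed :: "branch \<Rightarrow> bool" where
  "completed B \<longleftrightarrow> (\<forall>A. Tr A \<in># unmarked B \<or> Fl A \<in># unmarked B \<longrightarrow> literal A)"

definition T_closed :: "branch \<Rightarrow> bool" where
  "T_closed B \<longleftrightarrow> (\<exists>A. on (Tr A) B \<and> on (Tr (Neg A)) B)"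

definition closed_branch :: "branch \<Rightarrow> bool" where
  "closed_branch B \<longleftrightarrow> T_closed B \<or> (\<exists>A. on (Fl A) B \<and> on (Fl (Neg A)) B) \<or>
                       (\<exists>A. on (Tr A) B \<and> on (Fl A) B)"

definition At :: "branch \<Rightarrow> nat set" where
  "At B = {p. on (Tr (Atom p)) B}"

definition ignorable1 :: "branch \<Rightarrow> bool" where
  "ignorable1 B \<longleftrightarrow>
     completed B \<and> (\<exists>a. on (Fl (Neg (Atom a))) B \<and> \<not> on (Tr (Atom a)) B)"

definition ignorable2 :: "branch multiset \<Rightarrow> branch \<Rightarrow> bool" where
  "ignorable2 \<T> B \<longleftrightarrow> (\<exists>B' \<in># \<T>. completed B' \<and> \<not> T_closed B' \<and> At B' \<subset> At B)"

definition OTAB :: proof_system where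
  "OTAB \<Gamma> \<Delta> s \<longleftrightarrow>
     (\<exists>\<T>. tableau \<Gamma> \<Delta> \<T> s \<and>
          (\<forall>B \<in># \<T>. closed_branch B \<or> ignorable1 B \<or> ignorable2 \<T> B))"


section \<open>Simulation\<close>

definition simulates :: "proof_system \<Rightarrow> proof_system \<Rightarrow> bool" where
  "simulates f g \<longleftrightarrow>
     (\<exists>p :: nat poly. \<forall>\<Gamma> \<Delta> s. g \<Gamma> \<Delta> s \<longrightarrow> (\<exists>s' \<le> poly p s. f \<Gamma> \<Delta> s'))"

text \<open>There are arbitrarily large sequents with \<open>g\<close>-proofs of size polynomial in the sequent,
  which do have \<open>f\<close>-proofs, but only of size exponential in the sequent.\<close>

definition exponentially_separated :: "proof_system \<Rightarrow> proof_system \<Rightarrow> bool" where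
  "exponentially_separated f g \<longleftrightarrow>
     (\<exists>(q :: nat poly) (c :: real). c > 1 \<and>
        (\<forall>n. \<exists>\<Gamma> \<Delta>. let N = seq_size (MSeq \<Gamma> \<Delta>) in
           n \<le> N \<and>
           (\<exists>s \<le> poly q N. g \<Gamma> \<Delta> s) \<and>
           (\<exists>s. f \<Gamma> \<Delta> s) \<and>
           (\<forall>s. f \<Gamma> \<Delta> s \<longrightarrow> c ^ N \<le> real s)))"

end

theory Submission
  imports Defs "HOL-Real_Asymp.Real_Asymp"
begin

text \<open>The separating sequent has the premises \<open>p\<^sub>i \<or> q\<^sub>i\<close> for \<open>i \<le> n\<close> and the conclusion
  \<open>\<not> p\<^sub>0 \<or> \<not> q\<^sub>0\<close>. In MLK a single case distinction on \<open>p\<^sub>0 \<or> q\<^sub>0\<close> leaves one of \<open>p\<^sub>0\<close>, \<open>q\<^sub>0\<close>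
  without positive occurrence, and the minimality axiom applies. In a tableau no branch is ever
  closed, and no branch is ignorable of type 2, as a branch never contains both \<open>T p\<^sub>i\<close> and \<open>T q\<^sub>i\<close>
  whereas a completed one contains exactly one of them for every \<open>i\<close>. So each branch must be
  completed, even though the premises with \<open>i > 0\<close> are irrelevant, and a completed tableau
  has \<open>2\<^bsup>n+1\<^esup>\<close> branches.\<close>


section \<open>Separation and simulation\<close>

lemma nat_poly_mono:
  fixes p :: "nat poly"
  assumes "x \<le> y"
  shows "poly p x \<le> poly p y"
proof (induction p)
  case 0
  then show ?case by simp
next
  case (pCons a p)
  then have "x * poly p x \<le> y * poly p y"
    using assms by (intro mult_le_mono)
  then show ?case by simp
qed

text \<open>By induction on the coefficients, which are nonnegative. The base \<open>n + 1\<close>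
  is at least 1, so that the constant coefficient is absorbed also at \<open>n = 0\<close>.
  Replacing \<open>poly p n\<close> by a power with fixed exponent gives a form that automated
  asymptotics can compare with \<open>c ^ n\<close>.\<close>

lemma nat_poly_le_power:
  fixes p :: "nat poly"
  shows "\<exists>C k. \<forall>n. poly p n \<le> C * (n + 1) ^ k"
proof (induction p)
  case 0
  then show ?case by simp
next
  case (pCons a p)
  then obtain C k where C: "poly p n \<le> C * (n + 1) ^ k" for n by blast
  have "poly (pCons a p) n \<le> (a + C) * (n + 1) ^ Suc k" for n
  proof -
    have "a * 1 \<le> a * (n + 1) ^ Suc k"
      by (intro mult_le_mono) (auto simp del: power_Suc)
    moreover have "n * poly p n \<le> (n + 1) * (C * (n + 1) ^ k)"
      by (intro mult_le_mono C) auto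
    ultimately show ?thesis by (simp add: algebra_simps)
  qed
  then show ?case by blast
qed

lemma exponential_exceeds_nat_poly:
  fixes p :: "nat poly" and c :: real
  assumes "c > 1"
  shows "eventually (\<lambda>n. real (poly p n) < c ^ n) sequentially"
proof -
  obtain C k where C: "\<And>n. poly p n \<le> C * (n + 1) ^ k"
    using nat_poly_le_power by blast
  have "eventually (\<lambda>n. real C * (real n + 1) ^ k < c ^ n) sequentially"
    using assms by real_asymp
  then show ?thesis
  proof eventually_elim
    case (elim n)
    have "real (poly p n) \<le> real (C * (n + 1) ^ k)"
      using C of_nat_le_iff by blast
    with elim show ?case by (simp add: add.commute)
  qed
qed

text \<open>With \<open>g\<close>-proofs of size at most \<open>q(N)\<close>, a simulation with
  bound \<open>p\<close> gives \<open>f\<close>-proofs of size at most \<open>p(q(N))\<close>, as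
  \<open>p\<close> is monotone. This composition is again a polynomial and falls below
  \<open>c ^ N\<close> for large \<open>N\<close>.\<close>

lemma exponentially_separated_imp_not_simulates:
  assumes "exponentially_separated f g"
  shows "\<not> simulates f g"
proof
  assume "simulates f g"
  then obtain p :: "nat poly"
    where p: "\<And>\<Gamma> \<Delta> s. g \<Gamma> \<Delta> s \<Longrightarrow> \<exists>s' \<le> poly p s. f \<Gamma> \<Delta> s'"
    unfolding simulates_def by blast
  from assms obtain q :: "nat poly" and c :: real where "c > 1"
    and sep: "\<And>n. \<exists>\<Gamma> \<Delta>. n \<le> seq_size (MSeq \<Gamma> \<Delta>) \<and>
      (\<exists>s \<le> poly q (seq_size (MSeq \<Gamma> \<Delta>)). g \<Gamma> \<Delta> s) \<and>
      (\<forall>s. f \<Gamma> \<Delta> s \<longrightarrow> c ^ seq_size (MSeq \<Gamma> \<Delta>) \<le> real s)"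
    unfolding exponentially_separated_def Let_def by blast
  from exponential_exceeds_nat_poly[OF \<open>c > 1\<close>, of "pcompose p q"]
  obtain n where n: "\<And>N. n \<le> N \<Longrightarrow> real (poly p (poly q N)) < c ^ N"
    unfolding eventually_sequentially poly_pcompose by blast
  obtain \<Gamma> \<Delta> s where "n \<le> seq_size (MSeq \<Gamma> \<Delta>)" and s: "s \<le> poly q (seq_size (MSeq \<Gamma> \<Delta>))"
    and "g \<Gamma> \<Delta> s" and f: "\<And>s. f \<Gamma> \<Delta> s \<Longrightarrow> c ^ seq_size (MSeq \<Gamma> \<Delta>) \<le> real s"
    using sep[of n] by blast
  obtain s' where s': "s' \<le> poly p s" "f \<Gamma> \<Delta> s'"
    using p[OF \<open>g \<Gamma> \<Delta> s\<close>] by blast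
  have "s' \<le> poly p (poly q (seq_size (MSeq \<Gamma> \<Delta>)))"
    using s' nat_poly_mono[OF s] order_trans by blast
  then show False
    using n[OF \<open>n \<le> seq_size (MSeq \<Gamma> \<Delta>)\<close>] f[OF \<open>f \<Gamma> \<Delta> s'\<close>] by linarith
qed


section \<open>The separating sequents and their MLK derivations\<close>

text \<open>The atoms \<open>2 * i\<close> and \<open>2 * i + 1\<close> encode
  \<open>p\<^sub>i\<close> and \<open>q\<^sub>i\<close>.\<close>

definition clause :: "nat \<Rightarrow> fm" where
  "clause i = Or (Atom (2 * i)) (Atom (2 * i + 1))"

text \<open>The lower index \<open>m\<close> is a parameter because \<open>clauses 1 n\<close> are
  the side formulas left when the clause of index 0 is split.\<close>

definition clauses :: "nat \<Rightarrow> nat \<Rightarrow> fm fset" where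
  "clauses m n = fset_of_list (map clause [m..<Suc n])"

definition goal :: fm where
  "goal = Or (Neg (Atom 0)) (Neg (Atom 1))"

lemma fset_clauses: "fset (clauses m n) = clause ` {m..n}"
  by (auto simp: clauses_def fset_of_list.rep_eq)

lemma inj_clause: "inj clause"
  by (auto simp: inj_def clause_def)

lemma clauses_0: "clauses 0 n = finsert (clause 0) (clauses 1 n)"
  by (simp add: clauses_def upt_conv_Cons del: upt_Suc)

lemma fms_size_clauses: "fms_size (clauses m n) = 3 * (Suc n - m)"
proof -
  have "fms_size (clauses m n) = (\<Sum>i\<in>{m..n}. fm_size (clause i))"
    unfolding fms_size_def fset_clauses using inj_clause
    by (subst sum.reindex) (auto simp: inj_on_def)
  also have "\<dots> = 3 * (Suc n - m)"
    by (simp add: clause_def)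
  finally show ?thesis .
qed

lemma seq_size_goal: "seq_size (MSeq (clauses 0 n) {|goal|}) = 3 * n + 9"
  unfolding seq_size.simps fms_size_clauses by (simp add: fms_size_def goal_def)

lemma fms_size_finsert_le: "fms_size (finsert A \<Gamma>) \<le> fm_size A + fms_size \<Gamma>"
  by (cases "A |\<in>| \<Gamma>") (auto simp: fms_size_def finsert_absorb)

lemma derivation_snoc:
  assumes "derivation R \<pi>" "set Ps \<subseteq> set \<pi>" "R Ps S"
  shows "derivation R (\<pi> @ [S])"
  using assms unfolding derivation_def
  by (auto simp: nth_append less_Suc_eq)

text \<open>Five sequents, each no larger than the last one, whose size is \<open>3 * n + 9\<close>.
  The inferences \<open>mAx\<close>, \<open>mOrR1\<close>, \<open>mOrR2\<close> and
  \<open>mOrL\<close> have the same form for every \<open>adm\<close>, so one derivation serves all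
  variants of MLK.\<close>

lemma mlk_clauses_goal:
  "\<exists>s \<le> 5 * (3 * n + 9). mlk_system adm (clauses 0 n) {|goal|} s"
proof -
  define \<Gamma> where "\<Gamma> a = finsert (Atom a) (clauses 1 n)" for a
  define S1 where "S1 = MSeq (\<Gamma> 0) {|Neg (Atom 1)|}"
  define S2 where "S2 = MSeq (\<Gamma> 0) {|goal|}"
  define S3 where "S3 = MSeq (\<Gamma> 1) {|Neg (Atom 0)|}"
  define S4 where "S4 = MSeq (\<Gamma> 1) {|goal|}"
  define S5 where "S5 = MSeq (clauses 0 n) {|goal|}"
  note S_defs = S1_def S2_def S3_def S4_def S5_def
  \<comment> \<open>The positive atoms of \<open>\<Gamma> a\<close> are \<open>a\<close> and those
    of the clauses of index at least 1, which are all at least 2.\<close>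
  have ax: "mlk_step adm [] (MSeq (\<Gamma> a) {|Neg (Atom b)|})" if "a \<noteq> b" "b < 2" for a b
    using that by (intro mlk_step.mAx) (auto simp: \<Gamma>_def fset_clauses clause_def)
  have r1: "mlk_step adm [] S1"
    unfolding S_defs by (rule ax) auto
  have r2: "mlk_step adm [S1] S2"
    unfolding S_defs goal_def by (rule mlk_step.mOrR1)
  have r3: "mlk_step adm [] S3"
    unfolding S_defs by (rule ax) auto
  have r4: "mlk_step adm [S3] S4"
    unfolding S_defs goal_def by (rule mlk_step.mOrR2)
  have r5: "mlk_step adm [S2, S4] S5"
    unfolding S_defs \<Gamma>_def clauses_0 using mlk_step.mOrL[of adm "Atom 0" _ _ "Atom 1"]
    by (simp add: clause_def)
  let ?D = "derivation (mlk_step adm)"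
  have "?D []"
    by (simp add: derivation_def)
  from derivation_snoc[OF this _ r1] have "?D [S1]" by simp
  from derivation_snoc[OF this _ r2] have "?D [S1, S2]" by simp
  from derivation_snoc[OF this _ r3] have "?D [S1, S2, S3]" by simp
  from derivation_snoc[OF this _ r4] have "?D [S1, S2, S3, S4]" by simp
  from derivation_snoc[OF this _ r5] have "?D [S1, S2, S3, S4, S5]" by simp
  moreover have "fms_size (\<Gamma> a) \<le> 3 * n + 1" for a
    using fms_size_finsert_le[of "Atom a" "clauses 1 n"] by (simp add: \<Gamma>_def fms_size_clauses)
  from this[of 0] this[of 1] have "(\<Sum>S\<leftarrow>[S1, S2, S3, S4, S5]. seq_size S) \<le> 5 * (3 * n + 9)"
    using seq_size_goal[of n] by (simp add: S_defs fms_size_def goal_def)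
  ultimately show ?thesis
    unfolding mlk_system_def
    by (intro exI[of _ "\<Sum>S\<leftarrow>[S1, S2, S3, S4, S5]. seq_size S"] conjI
        exI[of _ "[S1, S2, S3, S4, S5]"]) (auto simp: S5_def)
qed


section \<open>Tableaux for the separating sequents\<close>

inductive_set tab_nodes :: "nat \<Rightarrow> sfm set" for n where
  clause: "i \<le> n \<Longrightarrow> Tr (clause i) \<in> tab_nodes n"
| goal: "Fl goal \<in> tab_nodes n"
| left: "i \<le> n \<Longrightarrow> Tr (Atom (2 * i)) \<in> tab_nodes n"
| right: "i \<le> n \<Longrightarrow> Tr (Atom (2 * i + 1)) \<in> tab_nodes n"
| neg0: "Fl (Neg (Atom 0)) \<in> tab_nodes n"
| neg1: "Fl (Neg (Atom 1)) \<in> tab_nodes n"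


lemmas tab_node_intros = tab_nodes.intros tab_nodes.intros[simplified]

text \<open>The invariant of all branches. The equation for \<open>i\<close> says that clause
  \<open>i\<close> is represented by exactly one unmarked node: the clause itself before it is
  split, the chosen disjunct afterwards. The last conjunct distinguishes the goal before and after
  its expansion.\<close>

definition tab_branch :: "nat \<Rightarrow> branch \<Rightarrow> bool" where
  "tab_branch n B \<longleftrightarrow>
     set_mset (unmarked B) \<subseteq> tab_nodes n \<and>
     set_mset (marked B) \<subseteq> Tr ` clause ` {..n} \<union> {Fl goal} \<and>
     (\<forall>i\<le>n. count (unmarked B) (Tr (clause i)) + count (unmarked B) (Tr (Atom (2 * i))) +
             count (unmarked B) (Tr (Atom (2 * i + 1))) = 1) \<and>
     (Fl goal \<in># unmarked B \<or>
      Fl (Neg (Atom 0)) \<in># unmarked B \<and> Fl (Neg (Atom 1)) \<in># unmarked B)"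

lemma clause_eq_iff [simp]: "clause i = clause j \<longleftrightarrow> i = j"
  using inj_clause by (simp add: inj_eq)

lemma clause_neq_Atom [simp]: "clause i \<noteq> Atom a" "Atom a \<noteq> clause i"
  by (auto simp: clause_def)

text \<open>A disjunction is of \<alpha> type when signed \<open>Fl\<close> and of \<beta> type when
  signed \<open>Tr\<close>, and literals are of neither type. This leaves the goal for rule (A) and
  the clauses for rule (B).\<close>

lemma alpha_tab_node:
  assumes "X \<in> tab_nodes n" "alpha X X1 X2"
  shows "X = Fl goal" "X1 = Fl (Neg (Atom 0))" "X2 = Fl (Neg (Atom 1))"
  using assms(2,1) by (cases; auto elim!: tab_nodes.cases simp: clause_def goal_def)+

lemma beta_tab_node:
  assumes "X \<in> tab_nodes n" "beta X X1 X2"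
  obtains i where "i \<le> n" "X = Tr (clause i)" "X1 = Tr (Atom (2 * i))" "X2 = Tr (Atom (2 * i + 1))"
  using assms(2,1) by (cases; auto elim!: tab_nodes.cases simp: clause_def goal_def)

lemma tab_branch_init: "tab_branch n (init_branch (clauses 0 n) {|goal|})"
proof -
  have "count (mset_set (Tr ` clause ` {0..n})) (Tr (clause i)) = 1" if "i \<le> n" for i
    using that by (subst count_mset_set) auto
  then show ?thesis
    by (auto simp: tab_branch_def init_branch_def fset_clauses image_iff intro: tab_node_intros)
qed

lemma tab_branch_alpha:
  assumes "tab_branch n (Branch M (add_mset X U))" "alpha X X1 X2"
  shows "tab_branch n (Branch (add_mset X M) (add_mset X1 (add_mset X2 U)))"
proof -
  have "X \<in> tab_nodes n"
    using assms(1) by (auto simp: tab_branch_def)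
  note X = alpha_tab_node[OF this assms(2)]
  show ?thesis
    using assms(1) unfolding X tab_branch_def by (auto intro: tab_node_intros)
qed

lemma tab_branch_beta:
  assumes "tab_branch n (Branch M (add_mset X U))" "beta X X1 X2"
  shows "tab_branch n (Branch (add_mset X M) (add_mset X1 U))"
    and "tab_branch n (Branch (add_mset X M) (add_mset X2 U))"
proof -
  have "X \<in> tab_nodes n"
    using assms(1) by (auto simp: tab_branch_def)
  then obtain i where X: "i \<le> n" "X = Tr (clause i)" "X1 = Tr (Atom (2 * i))"
      "X2 = Tr (Atom (2 * i + 1))"
    using beta_tab_node assms(2) by metis
  have parity: "2 * j \<noteq> Suc (2 * k)" "Suc (2 * k) \<noteq> 2 * j" for j k :: nat
    by presburger+
  have nodes: "Tr (Atom (2 * i)) \<in> tab_nodes n" "Tr (Atom (Suc (2 * i))) \<in> tab_nodes n"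
    using tab_nodes.left[OF X(1)] tab_nodes.right[OF X(1)] by simp_all
  have "tab_branch n (Branch (add_mset X M) (add_mset Y U))"
    if Y: "Y = Tr (Atom (2 * i)) \<or> Y = Tr (Atom (Suc (2 * i)))" for Y
  proof -
    \<comment> \<open>Splitting clause \<open>i\<close> trades one summand of its equation for
      another. By parity the new atom does not enter the equation of any other clause.\<close>
    have "count (add_mset Y U) (Tr (clause j)) + count (add_mset Y U) (Tr (Atom (2 * j))) +
        count (add_mset Y U) (Tr (Atom (2 * j + 1))) = 1" if "j \<le> n" for j
    proof -
      have "count (add_mset X U) (Tr (clause j)) + count (add_mset X U) (Tr (Atom (2 * j))) +
          count (add_mset X U) (Tr (Atom (2 * j + 1))) = 1"
        using assms(1) that unfolding tab_branch_def branch.sel by blast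
      then show ?thesis
        using Y by (cases "j = i") (auto simp: X(2) parity)
    qed
    moreover have "Y \<in> tab_nodes n"
      using Y nodes by blast
    ultimately show ?thesis
      using assms(1) X(1) by (auto simp: tab_branch_def X(2))
  qed
  then show "tab_branch n (Branch (add_mset X M) (add_mset X1 U))"
    and "tab_branch n (Branch (add_mset X M) (add_mset X2 U))"
    by (simp_all add: X(3,4))
qed

section \<open>Counting the branches\<close>

definition pending :: "branch \<Rightarrow> nat" where
  "pending B = size {#X \<in># unmarked B. \<exists>i. X = Tr (clause i)#}"

text \<open>The weight \<open>2 ^ pending B\<close> is the number of branches into which
  \<open>B\<close> grows when all its clauses are split. Splitting replaces one weight by two halves
  of it and expanding the goal changes none, so the total stays at its initial value. The last claim
  holds because each new branch comes with new nodes of positive size.\<close>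

lemma tableau_branches:
  assumes "tableau (clauses 0 n) {|goal|} \<T> k"
  shows "\<forall>B \<in># \<T>. tab_branch n B" and "(\<Sum>B\<in>#\<T>. 2 ^ pending B) = (2 ^ (n + 1) :: nat)"
    and "size \<T> \<le> k"
  using assms
proof (induction rule: tableau.induct)
  case start
  have "{#X \<in># mset_set (Tr ` clause ` {0..n}). \<exists>i. X = Tr (clause i)#} =
      mset_set (Tr ` clause ` {0..n})"
    by (auto simp: filter_mset_eq_conv)
  moreover have "card (Tr ` clause ` {0..n}) = n + 1"
    using inj_clause by (simp add: card_image inj_on_def)
  ultimately have "pending (init_branch (clauses 0 n) {|goal|}) = n + 1"
    by (auto simp: pending_def init_branch_def fset_clauses)
  then show "(\<Sum>B\<in>#{#init_branch (clauses 0 n) {|goal|}#}. 2 ^ pending B) = (2 ^ (n + 1) :: nat)"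
    by simp
  show "size {#init_branch (clauses 0 n) {|goal|}#}
      \<le> (\<Sum>X\<in>#unmarked (init_branch (clauses 0 n) {|goal|}). sfm_size X)"
    by (simp add: init_branch_def)
  show "\<forall>B \<in># {#init_branch (clauses 0 n) {|goal|}#}. tab_branch n B"
    using tab_branch_init by simp
next
  case (ruleA M X U \<T> k X1 X2)
  have "X \<in> tab_nodes n"
    using ruleA by (auto simp: tab_branch_def)
  note X = alpha_tab_node[OF this ruleA(2)]
  {
    case 1 then show ?case using tab_branch_alpha ruleA by auto
  next
    case 2 then show ?case using ruleA by (auto simp: pending_def X)
  next
    case 3 then show ?case using ruleA by simp
  }
next
  case (ruleB M X U \<T> k X1 X2)
  have "X \<in> tab_nodes n"
    using ruleB by (auto simp: tab_branch_def)
  then obtain i where X: "i \<le> n" "X = Tr (clause i)" "X1 = Tr (Atom (2 * i))"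
      "X2 = Tr (Atom (2 * i + 1))"
    using beta_tab_node ruleB(2) by metis
  {
    case 1 then show ?case using tab_branch_beta ruleB by auto
  next
    case 2 then show ?case using ruleB by (auto simp: pending_def X clause_def)
  next
    case 3 then show ?case using ruleB by (cases X1) (auto simp: X)
  }
qed

section \<open>Closed, ignorable and completed branches\<close>

lemma Tr_tab_node: "Tr A \<in> tab_nodes n \<Longrightarrow> \<exists>i. A = clause i \<or> A = Atom i"
  by (erule tab_nodes.cases) auto

lemma Fl_tab_node: "Fl A \<in> tab_nodes n \<Longrightarrow> A = goal \<or> A = Neg (Atom 0) \<or> A = Neg (Atom 1)"
  by (erule tab_nodes.cases) auto

text \<open>Nodes signed \<open>Tr\<close> are clauses and atoms, nodes signed \<open>Fl\<close> are
  the goal and two negated atoms. So no formula carries both signs, and none stands beside its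
  negation under the same sign.\<close>

lemma not_closed_tab_branch:
  assumes "tab_branch n B"
  shows "\<not> closed_branch B"
proof -
  have nodes: "X \<in> tab_nodes n" if "on X B" for X
    using assms that by (auto simp: tab_branch_def on_def intro: tab_node_intros)
  have "Tr (Neg A) \<notin> tab_nodes n" for A
    using Tr_tab_node[of "Neg A" n] by (auto simp: clause_def)
  moreover have "\<not> (Fl A \<in> tab_nodes n \<and> Fl (Neg A) \<in> tab_nodes n)" for A
    using Fl_tab_node[of A n] Fl_tab_node[of "Neg A" n] by (auto simp: goal_def)
  moreover have "\<not> (Tr A \<in> tab_nodes n \<and> Fl A \<in> tab_nodes n)" for A
    using Tr_tab_node[of A n] Fl_tab_node[of A n] by (auto simp: clause_def goal_def)
  ultimately show ?thesis
    unfolding closed_branch_def T_closed_def using nodes by blast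
qed

text \<open>Only clauses and the goal are ever marked. Hence the counts of unmarked nodes in the
  invariant determine \<open>At B\<close>.\<close>

lemma on_tab_branch_atom:
  assumes "tab_branch n B"
  shows "on (Tr (Atom a)) B \<longleftrightarrow> Tr (Atom a) \<in># unmarked B"
  using assms by (auto simp: on_def tab_branch_def clause_def)

lemma At_tab_branch_at_most_one:
  assumes "tab_branch n B" "i \<le> n"
  shows "\<not> (2 * i \<in> At B \<and> 2 * i + 1 \<in> At B)"
proof
  assume "2 * i \<in> At B \<and> 2 * i + 1 \<in> At B"
  then have "count (unmarked B) (Tr (Atom (2 * i))) > 0"
    "count (unmarked B) (Tr (Atom (2 * i + 1))) > 0"
    using assms by (auto simp: At_def on_tab_branch_atom)
  moreover have "count (unmarked B) (Tr (clause i)) + count (unmarked B) (Tr (Atom (2 * i))) +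
             count (unmarked B) (Tr (Atom (2 * i + 1))) = 1"
    using assms by (auto simp: tab_branch_def)
  ultimately show False by linarith
qed

lemma At_completed_tab_branch:
  assumes "tab_branch n B" "completed B" "i \<le> n"
  shows "2 * i \<in> At B \<or> 2 * i + 1 \<in> At B"
proof -
  have "Tr (clause i) \<notin># unmarked B"
    using assms by (auto simp: completed_def literal_def clause_def)
  then have "count (unmarked B) (Tr (clause i)) = 0"
    by (simp add: not_in_iff)
  moreover have "count (unmarked B) (Tr (clause i)) + count (unmarked B) (Tr (Atom (2 * i))) +
             count (unmarked B) (Tr (Atom (2 * i + 1))) = 1"
    using assms by (auto simp: tab_branch_def)
  ultimately have "count (unmarked B) (Tr (Atom (2 * i))) > 0 \<or>
    count (unmarked B) (Tr (Atom (2 * i + 1))) > 0"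
    by linarith
  then show ?thesis
    using assms by (auto simp: At_def on_tab_branch_atom)
qed

text \<open>Suppose \<open>a\<close> is in \<open>At B\<close> but not in \<open>At B'\<close>. The
  completed branch \<open>B'\<close> then contains the partner of \<open>a\<close> in its clause,
  and by inclusion so does \<open>B\<close>, which would have both atoms of one clause.\<close>

lemma not_ignorable2_tab_branch:
  assumes "\<forall>B \<in># \<T>. tab_branch n B" "tab_branch n B"
  shows "\<not> ignorable2 \<T> B"
proof
  assume "ignorable2 \<T> B"
  then obtain B' where B': "B' \<in># \<T>" "completed B'" "At B' \<subset> At B"
    unfolding ignorable2_def by blast
  then obtain a where a: "a \<in> At B" "a \<notin> At B'" by blast
  then have "Tr (Atom a) \<in> tab_nodes n"
    using assms(2) by (auto simp: At_def on_tab_branch_atom) (auto simp: tab_branch_def)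
  then obtain i where "i \<le> n" "a = 2 * i \<or> a = 2 * i + 1"
    by (auto elim!: tab_nodes.cases simp: clause_def)
  then show False
    using At_completed_tab_branch[of n B' i] At_tab_branch_at_most_one[of n B i] B' a assms
    by blast
qed

lemma literal_tab_node_iff:
  assumes "X \<in> tab_nodes n"
  shows "(\<forall>A. X = Tr A \<or> X = Fl A \<longrightarrow> literal A) \<longleftrightarrow> X \<noteq> Fl goal \<and> (\<forall>i. X \<noteq> Tr (clause i))"
  using assms by cases (auto simp: literal_def goal_def clause_def)

lemma completed_tab_branch_iff:
  assumes "tab_branch n B"
  shows "completed B \<longleftrightarrow> pending B = 0 \<and> Fl goal \<notin># unmarked B"
proof -
  have "completed B \<longleftrightarrow> (\<forall>X \<in># unmarked B. \<forall>A. X = Tr A \<or> X = Fl A \<longrightarrow> literal A)"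
    by (auto simp: completed_def)
  also have "\<dots> \<longleftrightarrow> (\<forall>X \<in># unmarked B. X \<noteq> Fl goal \<and> (\<forall>i. X \<noteq> Tr (clause i)))"
    using assms by (intro ball_cong refl literal_tab_node_iff) (auto simp: tab_branch_def)
  also have "\<dots> \<longleftrightarrow> pending B = 0 \<and> Fl goal \<notin># unmarked B"
    by (auto simp: pending_def)
  finally show ?thesis .
qed

text \<open>The expanded goal puts both \<open>Fl (Neg (Atom 0))\<close> and
  \<open>Fl (Neg (Atom 1))\<close> on the branch, while at most one of the atoms 0 and 1 is true
  there. The other atom is the witness.\<close>

lemma completed_tab_branch_ignorable1:
  assumes "tab_branch n B" "completed B"
  shows "ignorable1 B"
proof -
  have "on (Fl (Neg (Atom 0))) B \<and> on (Fl (Neg (Atom 1))) B"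
    using assms by (auto simp: completed_tab_branch_iff tab_branch_def on_def)
  moreover have "\<not> on (Tr (Atom 0)) B \<or> \<not> on (Tr (Atom 1)) B"
    using At_tab_branch_at_most_one[OF assms(1), of 0] by (auto simp: At_def)
  ultimately show ?thesis
    using assms(2) unfolding ignorable1_def by blast
qed

text \<open>Ignorability of type 1 is the only option left, and it demands completion. So all
  branches have weight 1, and the total weight \<open>2 ^ (n + 1)\<close> is their number.\<close>

lemma otab_clauses_goal_lower_bound:
  assumes "OTAB (clauses 0 n) {|goal|} s"
  shows "2 ^ (n + 1) \<le> s"
proof -
  obtain \<T> where \<T>: "tableau (clauses 0 n) {|goal|} \<T> s"
    "\<forall>B \<in># \<T>. closed_branch B \<or> ignorable1 B \<or> ignorable2 \<T> B"
    using assms unfolding OTAB_def by blast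
  note tab = tableau_branches[OF \<T>(1)]
  have "pending B = 0" if "B \<in># \<T>" for B
    using that tab(1) \<T>(2) not_closed_tab_branch not_ignorable2_tab_branch
      completed_tab_branch_iff unfolding ignorable1_def by blast
  then have "(\<Sum>B\<in>#\<T>. 2 ^ pending B) = (\<Sum>B\<in>#\<T>. 1 :: nat)"
    by (intro arg_cong[where f = sum_mset] image_mset_cong) simp
  then show ?thesis
    using tab by simp
qed

section \<open>Existence of OTAB-proofs\<close>

text \<open>The rules act on one branch and leave the rest \<open>\<T>\<close> as it is, so branches
  can be completed one at a time. Each expansion lowers the number of unmarked clauses and goals on
  the branch.\<close>

lemma tableau_complete_branch:
  assumes "tableau (clauses 0 n) {|goal|} (add_mset B \<T>) k"
  shows "\<exists>\<T>' k'. tableau (clauses 0 n) {|goal|} (\<T>' + \<T>) k' \<and> (\<forall>B \<in># \<T>'. completed B)"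
  using assms
proof (induction "pending B + count (unmarked B) (Fl goal)" arbitrary: B \<T> k rule: less_induct)
  case less
  have tab: "tab_branch n B"
    using tableau_branches[OF less.prems] by simp
  obtain M U where B: "B = Branch M U" by (cases B)
  consider "completed B" | "Fl goal \<in># U" | i where "Tr (clause i) \<in># U"
    using completed_tab_branch_iff[OF tab] B
    by (auto simp: pending_def)
  then show ?case
  proof cases
    case 1
    then show ?thesis
      using less.prems by (intro exI[of _ "{#B#}"] exI[of _ k]) simp
  next
    case 2
    then obtain V where V: "U = add_mset (Fl goal) V" by (metis insert_DiffM)
    have "alpha (Fl goal) (Fl (Neg (Atom 0))) (Fl (Neg (Atom 1)))"
      unfolding goal_def by (rule alpha.intros)
    from tableau.ruleA[OF less.prems[unfolded B V] this] show ?thesis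
      by (rule less.hyps[rotated]) (auto simp: B V pending_def goal_def)
  next
    case 3
    then obtain V where V: "U = add_mset (Tr (clause i)) V" by (metis insert_DiffM)
    define C where "C a = Branch (add_mset (Tr (clause i)) M) (add_mset (Tr (Atom a)) V)" for a
    have smaller: "pending (C a) + count (unmarked (C a)) (Fl goal)
        < pending B + count (unmarked B) (Fl goal)" for a
      by (auto simp: B V C_def pending_def clause_def)
    have "beta (Tr (clause i)) (Tr (Atom (2 * i))) (Tr (Atom (2 * i + 1)))"
      unfolding clause_def by (rule beta.intros)
    \<comment> \<open>The left branch is completed first, with the right one counted among the rest.
      Then the right one is completed, with the outcome \<open>\<T>1\<close> among the rest.\<close>
    from tableau.ruleB[OF less.prems[unfolded B V] this] obtain \<T>1 k1
      where 1: "tableau (clauses 0 n) {|goal|} (\<T>1 + add_mset (C (2 * i + 1)) \<T>) k1"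
        "\<forall>B \<in># \<T>1. completed B"
      using less.hyps[OF smaller] unfolding C_def by metis
    then have "tableau (clauses 0 n) {|goal|} (add_mset (C (2 * i + 1)) (\<T>1 + \<T>)) k1"
      by simp
    then obtain \<T>2 k2 where 2: "tableau (clauses 0 n) {|goal|} (\<T>2 + (\<T>1 + \<T>)) k2"
        "\<forall>B \<in># \<T>2. completed B"
      using less.hyps[OF smaller] by metis
    show ?thesis
      using 1 2 by (intro exI[of _ "\<T>2 + \<T>1"] exI[of _ k2]) (auto simp: add.assoc)
  qed
qed

lemma otab_clauses_goal: "\<exists>s. OTAB (clauses 0 n) {|goal|} s"
proof -
  obtain \<T> k where \<T>: "tableau (clauses 0 n) {|goal|} \<T> k" "\<forall>B \<in># \<T>. completed B"
    using tableau_complete_branch[OF tableau.start[of "clauses 0 n" "{|goal|}"]] by auto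
  then have "\<forall>B \<in># \<T>. ignorable1 B"
    using tableau_branches(1)[OF \<T>(1)] completed_tab_branch_ignorable1 by blast
  then show ?thesis
    using \<T>(1) unfolding OTAB_def by blast
qed

section \<open>The exponential separation\<close>

lemma exponentially_separated_OTAB_mlk: "exponentially_separated OTAB (mlk_system adm)"
proof -
  have "(2 powr (1 / 9)) ^ (3 * n + 9) \<le> real s" if "OTAB (clauses 0 n) {|goal|} s" for n s
  proof -
    have "(2 powr (1 / 9)) ^ (3 * n + 9) = (2 :: real) powr ((3 * real n + 9) / 9)"
      by (simp add: powr_realpow[symmetric] powr_powr)
    also have "\<dots> \<le> 2 powr real (n + 1)"
      by (intro powr_mono) auto
    also have "\<dots> = real (2 ^ (n + 1))"
      by (subst powr_realpow) auto
    also have "\<dots> \<le> real s"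
      using otab_clauses_goal_lower_bound[OF that] of_nat_le_iff by blast
    finally show ?thesis .
  qed
  note lower_bound = this
  show ?thesis
    unfolding exponentially_separated_def Let_def
  \<comment> \<open>The sequent has size \<open>N = 3 * n + 9\<close>. The polynomial is
    \<open>5 * N\<close>, and the base is the ninth root of 2 because
    \<open>N / 9 \<le> n + 1\<close>, with equality at \<open>n = 0\<close>.\<close>
  proof (intro exI[of _ "[:0, 5:]"] exI[of _ "2 powr (1 / 9)"] conjI allI)
    show "(1 :: real) < 2 powr (1 / 9)"
      by simp
    fix n
    show "\<exists>\<Gamma> \<Delta>. n \<le> seq_size (MSeq \<Gamma> \<Delta>) \<and>
        (\<exists>s \<le> poly [:0, 5:] (seq_size (MSeq \<Gamma> \<Delta>)). mlk_system adm \<Gamma> \<Delta> s) \<and>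
        (\<exists>s. OTAB \<Gamma> \<Delta> s) \<and>
        (\<forall>s. OTAB \<Gamma> \<Delta> s \<longrightarrow> (2 powr (1 / 9)) ^ seq_size (MSeq \<Gamma> \<Delta>) \<le> real s)"
      using mlk_clauses_goal[of n adm] otab_clauses_goal[of n] lower_bound[of n]
      by (intro exI[of _ "clauses 0 n"] exI[of _ "{|goal|}"] conjI)
        (simp_all only: seq_size_goal, auto simp: mult.commute)
  qed
qed

theorem theorem4:
  "\<forall>M \<in> {MLK, MLK_single}. \<not> simulates OTAB M \<and> exponentially_separated OTAB M"
  using exponentially_separated_OTAB_mlk exponentially_separated_imp_not_simulates
  by (auto simp: MLK_def MLK_single_def)

end
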